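(* Let $n\ge 1$ be an integer, $\kappa>0$, let $C\subseteq \mathbb{H}^n_\kappa$ be a closed $\kappa$-hyperbolically convex set, $p=(p_1,\dots,p_{n+1})^\top\in\mathbb{H}^n_\kappa$ and $u=(u_1,\dots,u_{n+1})^\top\in K_C\setminus\{0\}$. Consider the following statements: (i) $\displaystyle (p_{n+1}-u_{n+1})\Big(q_{n+1}-\frac{u_{n+1}}{\sqrt{-\kappa\langle u,u\rangle}}\Big)\ge 0$ for all $q=(q_1,\dots,q_{n+1})^\top\in C$; (ii) $\displaystyle (2p_{n+1}e^{n+1}-u)^\top\Big(q-\frac{u}{\sqrt{-\kappa\langle u,u\rangle}}\Big)\ge 0$ for all $q\in C$; (iii) if $u\in\Pi_{K_C}(p)$, then $\displaystyle P^\kappa_C(p)=\frac{u}{\sqrt{-\kappa\langle u,u\rangle}}$. Then the implications (i)$\implies$(ii)$\implies$(iii) hold.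
   Context: For $x,y\in\mathbb{R}^{n+1}$ the Lorentzian inner product is $\langle x,y\rangle:=x_1y_1+\dots+x_ny_n-x_{n+1}y_{n+1}$, while $x^\top y$ is the Euclidean inner product; $e^{n+1}=(0,\dots,0,1)^\top\in\mathbb{R}^{n+1}$. The $\kappa$-hyperbolic space form is $\mathbb{H}^n_\kappa:=\{p\in\mathbb{R}^{n+1}:\langle p,p\rangle=-1/\kappa,\ p_{n+1}>0\}$, with intrinsic distance $d_\kappa(p,q):=\frac{1}{\sqrt\kappa}\operatorname{arcosh}(-\kappa\langle p,q\rangle)$. It is a Riemannian manifold with the metric induced by $\langle\cdot,\cdot\rangle$ on tangent spaces; any two distinct points are joined by a unique geodesic segment, and a set $C\subseteq\mathbb{H}^n_\kappa$ is called $\kappa$-hyperbolically convex if for all $p,q\in C$ the geodesic segment joining $p$ to $q$ is contained in $C$. For a nonempty closed $\kappa$-hyperbolically convex set $C$, the intrinsic $\kappa$-projection $P^\kappa_C(p)$ of $p\in\mathbb{H}^n_\kappa$ is the unique minimizer of $q\mapsto d_\kappa(p,q)$ over $q\in C$. The cone spanned by $C$ is $K_C:=\{tp: p\in C,\ t\in[0,+\infty)\}$; it is a convex cone (not necessarily closed) when $C$ is $\kappa$-hyperbolically convex. For a convex cone $K\subseteq\mathbb{R}^{n+1}$, $\Pi_K(x)$ denotes the set of points $y\in K$ minimizing the Euclidean distance $\sqrt{(x-z)^\top(x-z)}$ over $z\in K$; it is either empty or a singleton. *)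

theory Defs
  imports "HOL-Analysis.Analysis"
begin

text \<open>
  The space of real \<open>(n+1)\<close>-vectors is \<open>(real ^ 'n) \<times> real\<close> with \<open>n = CARD('n) \<ge> 1\<close>: \<open>fst x\<close> holds the
  first \<open>n\<close> coordinates and \<open>snd x\<close> is the last coordinate. On this type \<open>\<bullet>\<close> and \<open>dist\<close> are
  the usual Euclidean inner product and distance.
\<close>

definition lorentz_inner :: "(real ^ 'n) \<times> real \<Rightarrow> (real ^ 'n) \<times> real \<Rightarrow> real" where
  "lorentz_inner x y = (\<Sum>i\<in>UNIV. fst x $ i * fst y $ i) - snd x * snd y"

definition e_last :: "(real ^ 'n) \<times> real" where
  "e_last = (0, 1)"

definition hyp_space :: "real \<Rightarrow> ((real ^ 'n) \<times> real) set" where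
  "hyp_space \<kappa> = {p. lorentz_inner p p = - 1 / \<kappa> \<and> snd p > 0}"

definition hyp_dist :: "real \<Rightarrow> (real ^ 'n) \<times> real \<Rightarrow> (real ^ 'n) \<times> real \<Rightarrow> real" where
  "hyp_dist \<kappa> p q = 1 / sqrt \<kappa> * arcosh (- \<kappa> * lorentz_inner p q)"

text \<open>The tangent space of the hyperboloid at one of its points \<open>p\<close>.\<close>

definition hyp_tangent :: "(real ^ 'n) \<times> real \<Rightarrow> ((real ^ 'n) \<times> real) set" where
  "hyp_tangent p = {w. lorentz_inner p w = 0}"

text \<open>
  Geodesics of the Riemannian metric induced by \<open>lorentz_inner\<close>. The covariant derivative of the
  velocity is the Lorentz-orthogonal projection of the ambient acceleration onto the tangent space,
  so it vanishes iff the acceleration is Lorentz-orthogonal to every tangent vector. Smoothness is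
  automatic: differentiating \<open>lorentz_inner (\<gamma> t) (\<gamma> t) = - 1 / \<kappa>\<close> twice shows that the condition
  forces \<open>\<gamma>'' = \<kappa> * lorentz_inner \<gamma>' \<gamma>' * \<gamma>\<close>.
\<close>

definition hyp_geodesic_between ::
  "real \<Rightarrow> (real \<Rightarrow> (real ^ 'n) \<times> real) \<Rightarrow> (real ^ 'n) \<times> real \<Rightarrow> (real ^ 'n) \<times> real \<Rightarrow> bool" where
  "hyp_geodesic_between \<kappa> \<gamma> p q \<longleftrightarrow>
     \<gamma> 0 = p \<and> \<gamma> 1 = q \<and> \<gamma> ` {0..1} \<subseteq> hyp_space \<kappa> \<and>
     (\<exists>\<gamma>' \<gamma>''. \<forall>t\<in>{0..1}.
        (\<gamma> has_vector_derivative \<gamma>' t) (at t within {0..1}) \<and>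
        (\<gamma>' has_vector_derivative \<gamma>'' t) (at t within {0..1}) \<and>
        (\<forall>w\<in>hyp_tangent (\<gamma> t). lorentz_inner (\<gamma>'' t) w = 0))"

text \<open>
  The geodesic segment between two points of \<open>hyp_space \<kappa>\<close> exists and is unique, so
  quantifying over all geodesics from \<open>p\<close> to \<open>q\<close> refers to exactly that segment.
\<close>

definition hyp_convex :: "real \<Rightarrow> ((real ^ 'n) \<times> real) set \<Rightarrow> bool" where
  "hyp_convex \<kappa> C \<longleftrightarrow> C \<subseteq> hyp_space \<kappa> \<and>
     (\<forall>p\<in>C. \<forall>q\<in>C. \<forall>\<gamma>. hyp_geodesic_between \<kappa> \<gamma> p q \<longrightarrow> \<gamma> ` {0..1} \<subseteq> C)"

definition hyp_proj ::
  "real \<Rightarrow> ((real ^ 'n) \<times> real) set \<Rightarrow> (real ^ 'n) \<times> real \<Rightarrow> (real ^ 'n) \<times> real" where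
  "hyp_proj \<kappa> C p = (THE q. is_arg_min (hyp_dist \<kappa> p) (\<lambda>q. q \<in> C) q)"

definition cone_spanned :: "((real ^ 'n) \<times> real) set \<Rightarrow> ((real ^ 'n) \<times> real) set" where
  "cone_spanned C = {t *\<^sub>R p | t p. p \<in> C \<and> 0 \<le> t}"

text \<open>Set-valued, since a minimizer need not exist when \<open>K\<close> is not closed.\<close>

definition euclid_proj :: "((real ^ 'n) \<times> real) set \<Rightarrow> (real ^ 'n) \<times> real \<Rightarrow> ((real ^ 'n) \<times> real) set" where
  "euclid_proj K x = {y. is_arg_min (dist x) (\<lambda>z. z \<in> K) y}"

end

theory Submission imports Defs begin

text \<open>
  Every Lorentzian product is a Euclidean one up to a correction in the last coordinate:
  \<open>lorentz_inner x y = x \<bullet> y - 2 * snd x * snd y\<close>. Write \<open>u = t *\<^sub>R v\<close> with \<open>v \<in> C\<close>; then \<open>v\<close> is the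
  normalisation of \<open>u\<close>. The left side of (ii) is twice that of (i) minus
  \<open>lorentz_inner u (q - v)\<close>, which is nonpositive by the reverse Cauchy--Schwarz inequality.
  If \<open>u\<close> is the Euclidean projection of \<open>p\<close> onto the convex cone, the variational inequality
  \<open>(p - u) \<bullet> (q - v) \<le> 0\<close> minus (ii) is \<open>lorentz_inner p (q - v) \<le> 0\<close>, so \<open>v\<close> is closest to \<open>p\<close>.
  It is the only closest point, since the geodesic between two closest points would contain a
  positive multiple of their sum, which is strictly closer.
\<close>

section \<open>The Lorentzian inner product on the hyperboloid\<close>

lemma lorentz_inner_eq: "lorentz_inner x y = fst x \<bullet> fst y - snd x * snd y"
  by (simp add: lorentz_inner_def inner_vec_def)

lemma lorentz_inner_eq_inner: "lorentz_inner x y = x \<bullet> y - 2 * snd x * snd y"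
  by (simp add: lorentz_inner_eq inner_prod_def)

lemma lorentz_inner_commute: "lorentz_inner x y = lorentz_inner y x"
  by (simp add: lorentz_inner_eq inner_commute)

lemma lorentz_inner_linear:
  "lorentz_inner (x + y) z = lorentz_inner x z + lorentz_inner y z"
  "lorentz_inner (x - y) z = lorentz_inner x z - lorentz_inner y z"
  "lorentz_inner (a *\<^sub>R x) z = a * lorentz_inner x z"
  "lorentz_inner z (x + y) = lorentz_inner z x + lorentz_inner z y"
  "lorentz_inner z (x - y) = lorentz_inner z x - lorentz_inner z y"
  "lorentz_inner z (a *\<^sub>R x) = a * lorentz_inner z x"
  by (simp_all add: lorentz_inner_eq inner_simps algebra_simps)

text \<open>With \<open>c = 1 / \<kappa>\<close> the hyperboloid equation fixes the norms
  \<open>a\<close>, \<open>b\<close> of the first parts, and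
  \<open>(snd p * snd q - c)\<^sup>2\<close> exceeds \<open>(a * b)\<^sup>2\<close> by
  \<open>c * (snd p - snd q)\<^sup>2\<close>. Euclidean Cauchy-Schwarz on the first parts finishes.
  Equality forces equal last coordinates, hence \<open>a = b\<close>, and then equal first
  parts.\<close>

lemma reverse_Cauchy_Schwarz:
  assumes \<kappa>: "\<kappa> > 0" and p: "p \<in> hyp_space \<kappa>" and q: "q \<in> hyp_space \<kappa>"
  shows "lorentz_inner p q \<le> - 1 / \<kappa>"
    and "lorentz_inner p q = - 1 / \<kappa> \<Longrightarrow> p = q"
proof -
  define c where "c = 1 / \<kappa>"
  define a b where "a = norm (fst p)" and "b = norm (fst q)"
  have c: "c > 0" using \<kappa> by (simp add: c_def)
  have pos: "snd p > 0" "snd q > 0" using p q by (auto simp: hyp_space_def)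
  have a2: "a\<^sup>2 = (snd p)\<^sup>2 - c" and b2: "b\<^sup>2 = (snd q)\<^sup>2 - c"
    using p q unfolding a_def b_def c_def power2_norm_eq_inner
    by (auto simp: hyp_space_def lorentz_inner_eq power2_eq_square)
  have sq: "(snd p * snd q - c)\<^sup>2 - (a * b)\<^sup>2 = c * (snd p - snd q)\<^sup>2"
    unfolding power_mult_distrib a2 b2 by (simp add: power2_eq_square algebra_simps)
  \<comment> \<open>Comparing squares bounds \<open>a * b\<close> only once
    \<open>snd p * snd q - c\<close> is known to be nonnegative; this holds because each squared
    last coordinate is at least \<open>c\<close>.\<close>
  have "c\<^sup>2 \<le> (snd p * snd q)\<^sup>2"
    unfolding power_mult_distrib power2_eq_square[of c]
    using a2 b2 c zero_le_power2[of a] zero_le_power2[of b] by (intro mult_mono) linarith+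
  then have nn: "c \<le> snd p * snd q"
    by (rule power2_le_imp_le) (use pos in simp)
  have "c * (snd p - snd q)\<^sup>2 \<ge> 0" using c by simp
  then have "(a * b)\<^sup>2 \<le> (snd p * snd q - c)\<^sup>2" using sq by linarith
  then have ab: "a * b \<le> snd p * snd q - c"
    by (rule power2_le_imp_le) (use nn in simp)
  have cs: "fst p \<bullet> fst q \<le> a * b"
    unfolding a_def b_def by (rule norm_cauchy_schwarz)
  show "lorentz_inner p q \<le> - 1 / \<kappa>"
    using ab cs by (simp add: lorentz_inner_eq c_def)
  show "p = q" if "lorentz_inner p q = - 1 / \<kappa>"
  proof -
    have eq: "a * b = snd p * snd q - c" "fst p \<bullet> fst q = a * b"
      using that ab cs by (auto simp: lorentz_inner_eq c_def)
    have "snd p = snd q" using sq c eq by auto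
    then have "a\<^sup>2 = b\<^sup>2" using a2 b2 by simp
    then have "a = b" by (simp add: a_def b_def)
    have "(norm (fst p - fst q))\<^sup>2 = a\<^sup>2 - 2 * (fst p \<bullet> fst q) + b\<^sup>2"
      unfolding a_def b_def power2_norm_eq_inner by (simp add: inner_diff inner_commute)
    then have "fst p = fst q" unfolding eq(2) \<open>a = b\<close> by (simp add: power2_eq_square)
    then show ?thesis using \<open>snd p = snd q\<close> by (simp add: prod_eq_iff)
  qed
qed

text \<open>The reverse Cauchy-Schwarz inequality puts both arguments of \<open>arcosh\<close> in
  its domain, where it is strictly increasing. Closest points to \<open>p\<close> thus become
  maximizers of a linear functional.\<close>

lemma hyp_dist_less_iff:
  assumes "\<kappa> > 0" "p \<in> hyp_space \<kappa>" "q \<in> hyp_space \<kappa>" "r \<in> hyp_space \<kappa>"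
  shows "hyp_dist \<kappa> p q < hyp_dist \<kappa> p r \<longleftrightarrow> lorentz_inner p r < lorentz_inner p q"
proof -
  have "1 \<le> - \<kappa> * lorentz_inner p q" "1 \<le> - \<kappa> * lorentz_inner p r"
    using reverse_Cauchy_Schwarz(1)[OF assms(1,2)] assms by (auto simp: field_simps)
  then show ?thesis
    using assms(1) by (simp add: hyp_dist_def divide_less_cancel)
qed

lemma is_arg_min_hyp_dist_iff:
  assumes \<kappa>: "\<kappa> > 0" and p: "p \<in> hyp_space \<kappa>" and C: "C \<subseteq> hyp_space \<kappa>"
  shows "is_arg_min (hyp_dist \<kappa> p) (\<lambda>q. q \<in> C) v \<longleftrightarrow>
           v \<in> C \<and> (\<forall>q\<in>C. lorentz_inner p q \<le> lorentz_inner p v)"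
  unfolding is_arg_min_def using hyp_dist_less_iff[OF \<kappa> p] C
  by (meson not_less subsetD)

lemma euclid_proj_iff: "u \<in> euclid_proj K p \<longleftrightarrow> u \<in> K \<and> (\<forall>z\<in>K. dist p u \<le> dist p z)"
  unfolding euclid_proj_def is_arg_min_linorder by blast

section \<open>Explicit geodesics and the convexity of the cone\<close>

definition hyp_segment ::
  "real \<Rightarrow> (real ^ 'n) \<times> real \<Rightarrow> (real ^ 'n) \<times> real \<Rightarrow> real \<Rightarrow> (real ^ 'n) \<times> real" where
  "hyp_segment d p q t =
     (sinh ((1 - t) * d) / sinh d) *\<^sub>R p + (sinh (t * d) / sinh d) *\<^sub>R q"

text \<open>For \<open>x = (1 - t) * d\<close> and \<open>y = t * d\<close> this is what keeps
  \<open>hyp_segment\<close> on the hyperboloid.\<close>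

lemma sinh_sum_identity:
  "(sinh x)\<^sup>2 + (sinh y)\<^sup>2 + 2 * sinh x * sinh y * cosh (x + y) = (sinh (x + y :: real))\<^sup>2"
proof -
  have "(sinh (x + y))\<^sup>2 = (sinh x)\<^sup>2 * (cosh y)\<^sup>2 + (cosh x)\<^sup>2 * (sinh y)\<^sup>2
          + 2 * sinh x * sinh y * (cosh x * cosh y)"
    by (simp add: sinh_add power2_eq_square algebra_simps)
  also have "\<dots> = (sinh x)\<^sup>2 + (sinh y)\<^sup>2 + 2 * sinh x * sinh y * cosh (x + y)"
    unfolding cosh_square_eq cosh_add by (simp add: power2_eq_square algebra_simps)
  finally show ?thesis by simp
qed

text \<open>The segment is spherical linear interpolation with \<open>sinh\<close> in place of
  \<open>sin\<close>, and \<open>d\<close> is \<open>sqrt \<kappa>\<close> times the distance. Both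
  weights solve \<open>f'' = d\<^sup>2 * f\<close>, so the acceleration is a multiple of the
  position, which is Lorentz-orthogonal to the tangent space.\<close>

lemma hyp_segment_geodesic:
  assumes \<kappa>: "\<kappa> > 0" and p: "p \<in> hyp_space \<kappa>" and q: "q \<in> hyp_space \<kappa>"
    and d: "d > 0" "cosh d = - \<kappa> * lorentz_inner p q"
  shows "hyp_geodesic_between \<kappa> (hyp_segment d p q) p q"
proof -
  let ?\<gamma> = "hyp_segment d p q"
  have sd: "sinh d > 0" using d by simp
  have in_space: "?\<gamma> t \<in> hyp_space \<kappa>" if t: "t \<in> {0..1}" for t
  proof -
    define x y where "x = sinh ((1 - t) * d)" and "y = sinh (t * d)"
    have xy: "x \<ge> 0" "y \<ge> 0" using t d by (auto simp: x_def y_def)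
    have "x > 0 \<or> y > 0"
      using t d by (cases "t = 0") (auto simp: x_def y_def)
    then have "snd (?\<gamma> t) > 0"
      using xy p q sd unfolding hyp_segment_def x_def[symmetric] y_def[symmetric]
      by (auto simp: hyp_space_def intro: add_pos_nonneg add_nonneg_pos)
    moreover have "x\<^sup>2 + y\<^sup>2 + 2 * x * y * cosh d = (sinh d)\<^sup>2"
      using sinh_sum_identity[of "(1 - t) * d" "t * d"]
      by (simp add: x_def y_def algebra_simps)
    moreover have "\<kappa> * lorentz_inner (?\<gamma> t) (?\<gamma> t) =
        (x\<^sup>2 * (\<kappa> * lorentz_inner p p) + y\<^sup>2 * (\<kappa> * lorentz_inner q q)
          + 2 * x * y * (\<kappa> * lorentz_inner p q)) / (sinh d)\<^sup>2"
      unfolding hyp_segment_def x_def[symmetric] y_def[symmetric]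
      by (simp add: lorentz_inner_linear lorentz_inner_commute[of q p] power2_eq_square
          add_divide_distrib algebra_simps)
    moreover have "\<kappa> * lorentz_inner p p = - 1" "\<kappa> * lorentz_inner q q = - 1"
        "\<kappa> * lorentz_inner p q = - cosh d"
      using p q \<kappa> d(2) by (simp_all add: hyp_space_def)
    ultimately have "\<kappa> * lorentz_inner (?\<gamma> t) (?\<gamma> t) = - (sinh d)\<^sup>2 / (sinh d)\<^sup>2" "snd (?\<gamma> t) > 0"
      by (simp_all flip: \<open>_ = (sinh d)\<^sup>2\<close>)
    then have "\<kappa> * lorentz_inner (?\<gamma> t) (?\<gamma> t) = - 1" "snd (?\<gamma> t) > 0"
      using sd by simp_all
    then show ?thesis using \<kappa> by (simp add: hyp_space_def field_simps)
  qed
  define D where "D t = (- d * cosh ((1 - t) * d) / sinh d) *\<^sub>R p + (d * cosh (t * d) / sinh d) *\<^sub>R q" for t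
  have scalar_derivs:
    "((\<lambda>t. sinh ((1 - t) * d) / sinh d) has_real_derivative - d * cosh ((1 - t) * d) / sinh d)
       (at t within {0..1})"
    "((\<lambda>t. sinh (t * d) / sinh d) has_real_derivative d * cosh (t * d) / sinh d)
       (at t within {0..1})"
    "((\<lambda>t. - d * cosh ((1 - t) * d) / sinh d) has_real_derivative
       d\<^sup>2 * (sinh ((1 - t) * d) / sinh d)) (at t within {0..1})"
    "((\<lambda>t. d * cosh (t * d) / sinh d) has_real_derivative d\<^sup>2 * (sinh (t * d) / sinh d))
       (at t within {0..1})" for t
    using sd by (auto intro!: derivative_eq_intros simp: power2_eq_square)
  note vector_deriv =
    has_vector_derivative_add[OF has_vector_derivative_scaleR[OF _ has_vector_derivative_const]
      has_vector_derivative_scaleR[OF _ has_vector_derivative_const]]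
  have "(?\<gamma> has_vector_derivative D t) (at t within {0..1})" for t
    using vector_deriv[OF scalar_derivs(1,2), of p q t] unfolding hyp_segment_def D_def by simp
  moreover have "(D has_vector_derivative d\<^sup>2 *\<^sub>R ?\<gamma> t) (at t within {0..1})" for t
    using vector_deriv[OF scalar_derivs(3,4), of p q t] unfolding hyp_segment_def D_def
    by (simp add: scaleR_add_right)
  moreover have "lorentz_inner (d\<^sup>2 *\<^sub>R ?\<gamma> t) w = 0" if "w \<in> hyp_tangent (?\<gamma> t)" for t w
    using that by (simp add: hyp_tangent_def lorentz_inner_linear)
  moreover have "?\<gamma> 0 = p" "?\<gamma> 1 = q" using sd by (simp_all add: hyp_segment_def)
  ultimately show ?thesis
    using in_space unfolding hyp_geodesic_between_def
    by (intro conjI exI[of _ D] exI[of _ "\<lambda>t. d\<^sup>2 *\<^sub>R ?\<gamma> t"]) auto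
qed

text \<open>The geodesic from \<open>p\<close> to \<open>q\<close> meets every ray spanned by a
  nonzero nonnegative combination of the two points.\<close>

lemma hyp_convex_add_in_cone:
  assumes \<kappa>: "\<kappa> > 0" and C: "hyp_convex \<kappa> C" and p: "p \<in> C" and q: "q \<in> C"
    and ab: "a \<ge> 0" "b \<ge> 0"
  shows "a *\<^sub>R p + b *\<^sub>R q \<in> cone_spanned C"
proof (cases "p = q \<or> a = 0 \<and> b = 0")
  case True
  then have "a *\<^sub>R p + b *\<^sub>R q = (a + b) *\<^sub>R p" by (auto simp: scaleR_add_left)
  then show ?thesis using p ab add_nonneg_nonneg unfolding cone_spanned_def by blast
next
  case False
  have H: "p \<in> hyp_space \<kappa>" "q \<in> hyp_space \<kappa>" using C p q by (auto simp: hyp_convex_def)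
  have "lorentz_inner p q < - 1 / \<kappa>"
    using reverse_Cauchy_Schwarz[OF \<kappa> H] False by (auto simp: order_less_le)
  then have gt: "- \<kappa> * lorentz_inner p q > 1" using \<kappa> by (simp add: field_simps)
  define d where "d = arcosh (- \<kappa> * lorentz_inner p q)"
  have d: "d > 0" "cosh d = - \<kappa> * lorentz_inner p q"
    using gt unfolding d_def by (auto simp: cosh_arcosh_real)
  have sd: "sinh d > 0" using d by simp
  \<comment> \<open>A zero of \<open>?h\<close> is a time at which the weights of \<open>p\<close>
    and \<open>q\<close> in the segment are in the ratio \<open>a : b\<close>. The values at 0 and 1
    are \<open>- b * sinh d\<close> and \<open>a * sinh d\<close>, so one exists.\<close>
  let ?h = "\<lambda>t. a * sinh (t * d) - b * sinh ((1 - t) * d)"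
  have "continuous_on {0..1} ?h" by (intro continuous_intros)
  then obtain t where t: "0 \<le> t" "t \<le> 1" "?h t = 0"
    using IVT'[of ?h 0 0 1] ab sd by auto
  let ?x = "sinh ((1 - t) * d)" and ?y = "sinh (t * d)"
  have "hyp_segment d p q t \<in> C"
    using C p q hyp_segment_geodesic[OF \<kappa> H d] t unfolding hyp_convex_def by fastforce
  moreover have pos: "?x \<ge> 0" "?y \<ge> 0" "?x + ?y > 0"
  proof -
    show "?x \<ge> 0" "?y \<ge> 0" using t d by simp_all
    have "?x > 0 \<or> ?y > 0" using t d by (cases "t = 0") simp_all
    then show "?x + ?y > 0"
      using \<open>?x \<ge> 0\<close> \<open>?y \<ge> 0\<close> by linarith
  qed
  have "a *\<^sub>R p + b *\<^sub>R q = ((a + b) * sinh d / (?x + ?y)) *\<^sub>R hyp_segment d p q t"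
  proof -
    have "(a + b) * ?x = a * (?x + ?y)" "(a + b) * ?y = b * (?x + ?y)"
      using t(3) by (simp_all add: algebra_simps)
    then have "(a + b) * ?x / (?x + ?y) = a" "(a + b) * ?y / (?x + ?y) = b"
      using pos(3) by (simp_all add: field_simps)
    then show ?thesis using sd by (simp add: hyp_segment_def scaleR_add_right)
  qed
  moreover have "(a + b) * sinh d / (?x + ?y) \<ge> 0" using ab sd pos by simp
  ultimately show ?thesis unfolding cone_spanned_def by blast
qed

lemma cone_cone_spanned: "cone (cone_spanned C)"
proof (unfold cone_def, intro ballI allI impI)
  fix x and s :: real
  assume "x \<in> cone_spanned C" "0 \<le> s"
  moreover from this obtain t y where "x = t *\<^sub>R y" "y \<in> C" "0 \<le> t"
    unfolding cone_spanned_def by blast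
  ultimately have "s *\<^sub>R x = (s * t) *\<^sub>R y" "y \<in> C" "0 \<le> s * t" by simp_all
  then show "s *\<^sub>R x \<in> cone_spanned C" unfolding cone_spanned_def by blast
qed

lemma convex_cone_spanned:
  assumes "\<kappa> > 0" "hyp_convex \<kappa> C"
  shows "convex (cone_spanned C)"
proof (rule convexI)
  fix x y and a b :: real
  assume "x \<in> cone_spanned C" "y \<in> cone_spanned C" and ab: "0 \<le> a" "0 \<le> b"
  then obtain s p t q where "x = s *\<^sub>R p" "y = t *\<^sub>R q" "p \<in> C" "q \<in> C" "0 \<le> s" "0 \<le> t"
    unfolding cone_spanned_def by auto
  then show "a *\<^sub>R x + b *\<^sub>R y \<in> cone_spanned C"
    using hyp_convex_add_in_cone[OF assms, of p q "a * s" "b * t"] ab by simp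
qed

section \<open>Variational inequalities and uniqueness of the closest point\<close>

lemma euclid_proj_inner_le:
  assumes "convex K" "u \<in> euclid_proj K p" "y \<in> K"
  shows "(p - u) \<bullet> (y - u) \<le> 0"
proof (rule ccontr)
  assume "\<not> ?thesis"
  then obtain s where s: "0 < s" "s \<le> 1" "dist (u + s *\<^sub>R (y - u)) p < dist u p"
    using closer_point_lemma[of p u y] by auto
  have u: "u \<in> K" using assms(2) by (simp add: euclid_proj_iff)
  have "(1 - s) *\<^sub>R u + s *\<^sub>R y \<in> K" using s assms(1,3) u by (intro convexD) auto
  moreover have "(1 - s) *\<^sub>R u + s *\<^sub>R y = u + s *\<^sub>R (y - u)" by (simp add: algebra_simps)
  ultimately show False
    using s assms(2) unfolding euclid_proj_iff by (metis dist_commute not_less)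
qed

lemma euclid_proj_cone_inner:
  assumes "convex K" "u \<in> euclid_proj K p" "cone K"
  shows "(p - u) \<bullet> u = 0" and "y \<in> K \<Longrightarrow> (p - u) \<bullet> y \<le> 0"
proof -
  have u: "u \<in> K" using assms(2) by (simp add: euclid_proj_iff)
  \<comment> \<open>The points 0 and \<open>2 *\<^sub>R u\<close> of the cone lie on opposite sides
    of \<open>u\<close> on its ray, so the variational inequality holds with both signs.\<close>
  show 0: "(p - u) \<bullet> u = 0"
    using euclid_proj_inner_le[OF assms(1,2) mem_cone[OF assms(3) u, of 0]]
      euclid_proj_inner_le[OF assms(1,2) mem_cone[OF assms(3) u, of 2]]
    by (simp add: inner_diff_right)
  show "(p - u) \<bullet> y \<le> 0" if "y \<in> K"
    using euclid_proj_inner_le[OF assms(1,2) that] 0 by (simp add: inner_diff_right)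
qed

lemma hyp_dist_minimizer_unique:
  assumes \<kappa>: "\<kappa> > 0" and C: "hyp_convex \<kappa> C" and p: "p \<in> hyp_space \<kappa>"
    and q: "is_arg_min (hyp_dist \<kappa> p) (\<lambda>q. q \<in> C) q"
    and r: "is_arg_min (hyp_dist \<kappa> p) (\<lambda>q. q \<in> C) r"
  shows "q = r"
proof (rule ccontr)
  assume ne: "q \<noteq> r"
  have CH: "\<And>x. x \<in> C \<Longrightarrow> x \<in> hyp_space \<kappa>" using C by (auto simp: hyp_convex_def)
  have qr: "q \<in> C" "r \<in> C" using q r by (simp_all add: is_arg_min_def)
  have min: "lorentz_inner p x \<le> lorentz_inner p q" "lorentz_inner p x \<le> lorentz_inner p r"
    if "x \<in> C" for x
    using q r that CH is_arg_min_hyp_dist_iff[OF \<kappa> p, of C] by blast+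
  then have eq: "lorentz_inner p q = lorentz_inner p r" using qr by (meson order_antisym)
  obtain s m where m: "m \<in> C" "s \<ge> 0" "q + r = s *\<^sub>R m"
    using hyp_convex_add_in_cone[OF \<kappa> C qr, of 1 1] by (auto simp: cone_spanned_def)
  have "lorentz_inner q r < - 1 / \<kappa>"
    using reverse_Cauchy_Schwarz[OF \<kappa> CH[OF qr(1)] CH[OF qr(2)]] ne by (auto simp: order_less_le)
  \<comment> \<open>The two squares contribute \<open>- 2 / \<kappa>\<close> and the cross terms
    strictly less than \<open>- 2 / \<kappa>\<close>; since \<open>m\<close> lies on the
    hyperboloid, this makes \<open>s > 2\<close>.\<close>
  then have "lorentz_inner (q + r) (q + r) < - 4 / \<kappa>"
    using CH[OF qr(1)] CH[OF qr(2)]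
    by (simp add: hyp_space_def lorentz_inner_linear lorentz_inner_commute[of r q])
  moreover have "lorentz_inner (q + r) (q + r) = - (s\<^sup>2) / \<kappa>"
    using CH[OF m(1)] unfolding m(3)
    by (simp add: hyp_space_def lorentz_inner_linear power2_eq_square)
  ultimately have "s\<^sup>2 > 2\<^sup>2" using \<kappa> by (simp add: divide_less_cancel)
  then have s: "s > 2" using m(2) by (rule power2_less_imp_less)
  have "2 * lorentz_inner p q = s * lorentz_inner p m"
    using arg_cong[OF m(3), of "lorentz_inner p"] eq by (simp add: lorentz_inner_linear)
  moreover have "lorentz_inner p m < 0"
    using reverse_Cauchy_Schwarz(1)[OF \<kappa> p CH[OF m(1)]] \<kappa>
    by (meson divide_neg_pos le_less_trans neg_less_0_iff_less zero_less_one)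
  \<comment> \<open>The product with \<open>p\<close> is negative, so shrinking the factor from
    \<open>s\<close> to 2 increases it: \<open>m\<close> is strictly closer to \<open>p\<close> than
    \<open>q\<close> is.\<close>
  then have "s * lorentz_inner p m < 2 * lorentz_inner p m" using s by simp
  ultimately show False using min(1)[OF m(1)] by simp
qed

theorem proposition9:
  fixes \<kappa> :: real and C :: "((real ^ 'n) \<times> real) set" and p u :: "(real ^ 'n) \<times> real"
  assumes "\<kappa> > 0"
    and "closedin (top_of_set (hyp_space \<kappa>)) C"
    and "hyp_convex \<kappa> C"
    and "p \<in> hyp_space \<kappa>"
    and "u \<in> cone_spanned C - {0}"
  shows "((\<forall>q\<in>C. (snd p - snd u) * (snd q - snd u / sqrt (- \<kappa> * lorentz_inner u u)) \<ge> 0) \<longrightarrow>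
          (\<forall>q\<in>C. ((2 * snd p) *\<^sub>R e_last - u) \<bullet> (q - u /\<^sub>R sqrt (- \<kappa> * lorentz_inner u u)) \<ge> 0)) \<and>
         ((\<forall>q\<in>C. ((2 * snd p) *\<^sub>R e_last - u) \<bullet> (q - u /\<^sub>R sqrt (- \<kappa> * lorentz_inner u u)) \<ge> 0) \<longrightarrow>
          (u \<in> euclid_proj (cone_spanned C) p \<longrightarrow>
            hyp_proj \<kappa> C p = u /\<^sub>R sqrt (- \<kappa> * lorentz_inner u u)))"
proof -
  have CS: "C \<subseteq> hyp_space \<kappa>" using assms(3) by (simp add: hyp_convex_def)
  note CH = subsetD[OF CS]
  obtain t v where tv: "u = t *\<^sub>R v" "v \<in> C" "t \<ge> 0" "u \<noteq> 0"
    using assms(5) unfolding cone_spanned_def by blast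
  then have "t \<noteq> 0" by auto
  with tv have u: "u = t *\<^sub>R v" "v \<in> C" "t > 0" by simp_all
  have vv: "lorentz_inner v v = - 1 / \<kappa>" using CH[OF u(2)] by (simp add: hyp_space_def)
  have "- \<kappa> * lorentz_inner u u = t\<^sup>2"
    using vv assms(1) by (simp add: u lorentz_inner_linear power2_eq_square)
  then have root: "sqrt (- \<kappa> * lorentz_inner u u) = t" using u(3) by simp
  have v: "u /\<^sub>R t = v" and sv: "snd u / t = snd v" using u by auto
  \<comment> \<open>The right side equals
    \<open>2 * (snd p - snd u) * snd w - lorentz_inner u w\<close>, used for (ii) from (i), and also
    \<open>(p - u) \<bullet> w - lorentz_inner p w\<close>, used for (iii) from (ii).\<close>
  have expand: "((2 * snd p) *\<^sub>R e_last - u) \<bullet> w = 2 * snd p * snd w - u \<bullet> w" for w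
    by (simp add: inner_diff_left inner_prod_def e_last_def algebra_simps)
  show ?thesis unfolding root v sv
  proof (intro conjI impI ballI)
    fix q assume q: "q \<in> C" and "\<forall>q\<in>C. 0 \<le> (snd p - snd u) * (snd q - snd v)"
    then have i: "0 \<le> (snd p - snd u) * snd (q - v)" by simp
    have "lorentz_inner v (q - v) \<le> 0"
      using reverse_Cauchy_Schwarz(1)[OF assms(1) CH[OF u(2)] CH[OF q]] vv
      by (simp add: lorentz_inner_linear)
    then have "lorentz_inner u (q - v) \<le> 0"
      using u by (simp add: lorentz_inner_linear(3) mult_nonneg_nonpos)
    then show "0 \<le> ((2 * snd p) *\<^sub>R e_last - u) \<bullet> (q - v)"
      using i unfolding expand lorentz_inner_eq_inner by (simp add: algebra_simps)
  next
    assume ii: "\<forall>q\<in>C. 0 \<le> ((2 * snd p) *\<^sub>R e_last - u) \<bullet> (q - v)"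
      and proj: "u \<in> euclid_proj (cone_spanned C) p"
    note K = euclid_proj_cone_inner[OF convex_cone_spanned[OF assms(1,3)] proj cone_cone_spanned]
    have "is_arg_min (hyp_dist \<kappa> p) (\<lambda>q. q \<in> C) v"
      unfolding is_arg_min_hyp_dist_iff[OF assms(1,4) CS]
    proof (intro conjI ballI)
      fix q assume q: "q \<in> C"
      have "q \<in> cone_spanned C"
        using q hyp_convex_add_in_cone[OF assms(1,3) q q, of 1 0] by simp
      then have "(p - u) \<bullet> q \<le> 0" by (rule K(2))
      \<comment> \<open>The residual is orthogonal to the whole ray through \<open>u\<close>, so it
        may be tested against \<open>q - v\<close> although the projection is \<open>u\<close>, not
        \<open>v\<close>.\<close>
      moreover have "(p - u) \<bullet> v = 0" using K(1) u(3) unfolding u(1) by simp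
      ultimately have "(p - u) \<bullet> (q - v) \<le> 0" by (simp add: inner_diff_right)
      then have "lorentz_inner p (q - v) \<le> 0"
        using bspec[OF ii q] unfolding expand lorentz_inner_eq_inner by (simp add: inner_diff_left)
      then show "lorentz_inner p q \<le> lorentz_inner p v" by (simp add: lorentz_inner_linear)
    qed (fact u(2))
    then show "hyp_proj \<kappa> C p = v"
      unfolding hyp_proj_def
      by (intro the_equality hyp_dist_minimizer_unique[OF assms(1,3,4)])
  qed
qed

end
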